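(* Let $d$ be a power of two, let $\sigma,h>0$, and let $H\in\mathbb{R}^{d\times d}$ be a symmetric matrix with positive trace and eigen-decomposition $H=RDR^T$, where $R$ is orthogonal and $D$ is diagonal with diagonal entries in increasing order $D_1\le\dots\le D_d$. Define: - $U^*=I$; - $\Sigma^*$ a solution of the following optimization problem over diagonal matrices $\Sigma\in\mathbb{R}^{d\times d}$ with diagonal entries $\Sigma_1,\dots,\Sigma_d$ and $\Sigma_{max}=\max_i\Sigma_i$: $$\Sigma^*=\operatorname*{arg\,min}_{\Sigma}\begin{cases}\dfrac{\left(\sum_{i=1}^d D_i\Sigma_i^2\right)^2}{4d\,\Sigma_{max}^2}+\sigma^2\displaystyle\sum_{i=1}^d\frac{1}{\Sigma_i^2}+\sigma^2\frac{d}{\Sigma_{max}^2} & \text{if } hI\succeq\Sigma\succ0,\\ \infty & \text{otherwise;}\end{cases}$$ - $V^*=M_k$, where $k=\operatorname*{arg\,max}_i\Sigma^*_i$. Then $S^*=RU^*\Sigma^*(V^* )^T$ is a global minimizer of $l_{H,\sigma,h}$ over $\mathbb{R}^{d\times d}$.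
   Context: For symmetric $H\in\mathbb{R}^{d\times d}$ and $\sigma,h>0$, the function $l_{H,\sigma,h}:\mathbb{R}^{d\times d}\to[0,\infty]$ is $$l_{H,\sigma,h}(S)=\frac14\left\|S^{-T}[s_1^THs_1,\dots,s_d^THs_d]^T\right\|_2^2+\sigma^2\|S^{-1}\|_F^2+\sigma^2\|S^{-T}\mathbf{1}\|_2^2$$ if $S$ is invertible and $\|S\|_2\le h$ (spectral norm), and $l_{H,\sigma,h}(S)=\infty$ otherwise. Here $s_i$ is the $i$-th column of $S$, $S^{-T}=(S^T)^{-1}$, $\mathbf{1}\in\mathbb{R}^d$ is the all-ones vector, and $\|\cdot\|_F$ is the Frobenius norm. $M_k\in\mathbb{R}^{d\times d}$ denotes a (normalized) Hadamard matrix: an orthogonal matrix with $(M_k)_{ij}^2=\frac1d$ for all $i,j$ and with all entries of its $k$-th column positive (hence equal to $1/\sqrt d$). *)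

theory Defs
  imports "HOL-Analysis.Analysis"
begin

definition symmetric_mat :: "real^'d^'d \<Rightarrow> bool" where
  "symmetric_mat A \<longleftrightarrow> transpose A = A"

definition diagonal_mat :: "real^'d^'d \<Rightarrow> bool" where
  "diagonal_mat A \<longleftrightarrow> (\<forall>i j. i \<noteq> j \<longrightarrow> A $ i $ j = 0)"

definition pos_semidef :: "real^'d^'d \<Rightarrow> bool" where
  "pos_semidef A \<longleftrightarrow> symmetric_mat A \<and> (\<forall>x. 0 \<le> x \<bullet> (A *v x))"

definition pos_def :: "real^'d^'d \<Rightarrow> bool" where
  "pos_def A \<longleftrightarrow> symmetric_mat A \<and> (\<forall>x. x \<noteq> 0 \<longrightarrow> 0 < x \<bullet> (A *v x))"

definition spectral_norm :: "real^'d^'d \<Rightarrow> real" where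
  "spectral_norm A = onorm (\<lambda>x. A *v x)"

definition quad_vec :: "real^'d^'d \<Rightarrow> real^'d^'d \<Rightarrow> real^'d" where
  "quad_vec H S = (\<chi> i. column i S \<bullet> (H *v column i S))"

(* On matrices, norm is the Frobenius norm: the Euclidean norm of the vector of row norms. *)
definition loss :: "real^'d^'d \<Rightarrow> real \<Rightarrow> real \<Rightarrow> real^'d^'d \<Rightarrow> ennreal" where
  "loss H \<sigma> h S =
     (if invertible S \<and> spectral_norm S \<le> h
      then ennreal (1 / 4 * (norm (matrix_inv (transpose S) *v quad_vec H S))\<^sup>2
                    + \<sigma>\<^sup>2 * (norm (matrix_inv S))\<^sup>2
                    + \<sigma>\<^sup>2 * (norm (matrix_inv (transpose S) *v (\<chi> i. 1)))\<^sup>2)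
      else \<infinity>)"

definition max_diag :: "real^'d^'d \<Rightarrow> real" where
  "max_diag A = Max (range (\<lambda>i. A $ i $ i))"

definition reduced_loss :: "real^'d^'d \<Rightarrow> real \<Rightarrow> real \<Rightarrow> real^'d^'d \<Rightarrow> ennreal" where
  "reduced_loss D \<sigma> h \<Sigma> =
     (if pos_semidef (h *\<^sub>R mat 1 - \<Sigma>) \<and> pos_def \<Sigma>
      then ennreal ((\<Sum>i\<in>UNIV. D $ i $ i * (\<Sigma> $ i $ i)\<^sup>2)\<^sup>2 / (4 * real CARD('d) * (max_diag \<Sigma>)\<^sup>2)
                    + \<sigma>\<^sup>2 * (\<Sum>i\<in>UNIV. 1 / (\<Sigma> $ i $ i)\<^sup>2)
                    + \<sigma>\<^sup>2 * (real CARD('d) / (max_diag \<Sigma>)\<^sup>2))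
      else \<infinity>)"

definition hadamard_mat :: "'d \<Rightarrow> real^'d^'d \<Rightarrow> bool" where
  "hadamard_mat k M \<longleftrightarrow>
     orthogonal_matrix M \<and> (\<forall>i j. (M $ i $ j)\<^sup>2 = 1 / real CARD('d)) \<and> (\<forall>i. 0 < M $ i $ k)"

end

theory Submission
  imports Defs
begin

text \<open>Put \<open>A = S S\<^sup>T\<close>, let \<open>q\<^sub>i\<close> be an orthonormal eigenframe of \<open>A\<close> with eigenvalues \<open>b\<^sub>i\<close>,
  and let \<open>m\<close> be the largest \<open>b\<^sub>i\<close>. Cauchy-Schwarz against \<open>S 1\<close>, whose squared norm is at most \<open>m d\<close>,
  bounds the first and third terms of the loss below by \<open>tr(D R\<^sup>T A R)\<^sup>2 / (4 d m)\<close> and \<open>\<sigma>\<^sup>2 d / m\<close>.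
  The eigenframe can be chosen to minimise \<open>\<Sum> D\<^sub>i (q\<^sub>i \<bullet> A q\<^sub>i)\<close> over all orthonormal frames, so
  \<open>\<Sum> D\<^sub>i b\<^sub>i \<le> tr(D R\<^sup>T A R)\<close>. If the left side is negative, then, since \<open>D\<close> has positive trace, raising
  the \<open>b\<^sub>i\<close> towards \<open>m\<close> makes it zero and only decreases the other terms. Hence the reduced loss at
  the square roots of the resulting weights is at most the loss at \<open>S\<close>. Conversely
  \<open>R \<Sigma> V\<^sup>T\<close> attains the reduced loss at \<open>\<Sigma>\<close>, because the entries of the Hadamard matrix make the quadratic
  vector constant and \<open>V\<^sup>T 1\<close> a multiple of the \<open>k\<close>-th basis vector.\<close>

section \<open>Orthogonal matrices, Frobenius norm and operator bounds\<close>

lemma orthogonal_matrix_iff_inner_rows: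
  fixes Q :: "real^'n^'n"
  shows "orthogonal_matrix Q \<longleftrightarrow> (\<forall>i j. Q $ i \<bullet> Q $ j = (if i = j then 1 else 0))"
  unfolding orthogonal_matrix_orthonormal_rows row_def vec_nth_inverse orthogonal_def
  by (auto simp: norm_eq_1)

lemma norm_matrix_power2:
  fixes A :: "real^'n^'m"
  shows "(norm A)\<^sup>2 = (\<Sum>i\<in>UNIV. (norm (A $ i))\<^sup>2)"
  by (simp add: norm_vec_def L2_set_def sum_nonneg)

lemma norm_transpose:
  fixes A :: "real^'n^'m"
  shows "norm (transpose A) = norm A"
proof -
  have "(norm (transpose A))\<^sup>2 = (norm A)\<^sup>2"
    unfolding norm_matrix_power2 power2_norm_eq_inner inner_vec_def transpose_def
    by (simp add: sum.swap[of _ "UNIV :: 'n set"])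
  then show ?thesis by (simp add: power2_eq_iff_nonneg)
qed

lemma norm_orthogonal_matrix_vector_mult:
  fixes Q :: "real^'n^'n"
  assumes "orthogonal_matrix Q"
  shows "norm (Q *v x) = norm x"
proof -
  have "orthogonal_transformation ((*v) Q)"
    using assms by (simp add: orthogonal_transformation_matrix matrix_of_matrix_vector_mul)
  then show ?thesis by (rule orthogonal_transformation_norm)
qed

lemma norm_matrix_mult_orthogonal_right:
  fixes A :: "real^'n^'m"
  assumes "orthogonal_matrix Q"
  shows "norm (A ** Q) = norm A"
proof -
  have "(A ** Q) $ i = transpose Q *v A $ i" for i
    by (simp add: vec_eq_iff matrix_matrix_mult_def matrix_vector_mult_def transpose_def mult.commute)
  then have "(norm (A ** Q))\<^sup>2 = (norm A)\<^sup>2"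
    using assms by (simp add: norm_matrix_power2 norm_orthogonal_matrix_vector_mult del: transpose_matrix_vector)
  then show ?thesis by (simp add: power2_eq_iff_nonneg)
qed

lemma norm_matrix_mult_orthogonal_left:
  fixes A :: "real^'m^'n"
  assumes "orthogonal_matrix Q"
  shows "norm (Q ** A) = norm A"
  using norm_matrix_mult_orthogonal_right[of "transpose Q" "transpose A"] assms
  by (simp flip: matrix_transpose_mul add: norm_transpose)

text \<open>The Frobenius norm can be read off any orthonormal frame. This later splits the norm of
  \<open>matrix_inv S\<close> along eigenvectors of \<open>S ** transpose S\<close>.\<close>

lemma sum_norm_mult_orthogonal_rows:
  fixes A :: "real^'n^'m"
  assumes "orthogonal_matrix Q"
  shows "(\<Sum>i\<in>UNIV. (norm (A *v (Q $ i)))\<^sup>2) = (norm A)\<^sup>2"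
proof -
  have "transpose (A ** transpose Q) $ i = A *v (Q $ i)" for i
    by (simp add: vec_eq_iff matrix_matrix_mult_def matrix_vector_mult_def transpose_def)
  then have "(\<Sum>i\<in>UNIV. (norm (A *v (Q $ i)))\<^sup>2) = (norm (transpose (A ** transpose Q)))\<^sup>2"
    by (simp add: norm_matrix_power2)
  then show ?thesis
    using assms by (simp add: norm_transpose norm_matrix_mult_orthogonal_right)
qed

text \<open>The squared norm of \<open>transpose M *v y\<close> is the inner product of
  \<open>y\<close> with \<open>M *v (transpose M *v y)\<close>; Cauchy-Schwarz and the bound on
  \<open>M\<close> leave one factor to cancel.\<close>

lemma norm_transpose_mult_le:
  fixes M :: "real^'n^'m"
  assumes "\<And>x. norm (M *v x) \<le> c * norm x"
  shows "norm (transpose M *v y) \<le> c * norm y"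
proof (cases "transpose M *v y = 0")
  case True
  \<comment> \<open>Testing the bound on a unit vector shows the sign of \<open>c\<close>;
    \<open>undefined\<close> is just some index.\<close>
  have "0 \<le> c"
    using order_trans[OF norm_ge_zero assms[of "axis undefined 1"]] by simp
  with True show ?thesis by simp
next
  case False
  have "(norm (transpose M *v y))\<^sup>2 = y \<bullet> (M *v (transpose M *v y))"
    by (simp add: power2_norm_eq_inner dot_lmul_matrix flip: transpose_matrix_vector)
      (metis dot_lmul_matrix transpose_matrix_vector)
  also have "\<dots> \<le> norm y * norm (M *v (transpose M *v y))"
    by (rule norm_cauchy_schwarz)
  also have "\<dots> \<le> norm y * (c * norm (transpose M *v y))"
    by (intro mult_left_mono assms) auto
  finally show ?thesis using False by (simp add: power2_eq_square algebra_simps)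
qed

section \<open>Eigenframes as minimisers of a weighted trace\<close>

lemma compact_orthogonal_matrices: "compact {Q :: real^'n^'n. orthogonal_matrix Q}"
  unfolding compact_eq_bounded_closed
proof
  \<comment> \<open>The rows are unit vectors, so all orthogonal matrices lie on one Frobenius
    sphere.\<close>
  have "norm Q = sqrt (real CARD('n))" if "orthogonal_matrix Q" for Q :: "real^'n^'n"
  proof -
    have "(norm Q)\<^sup>2 = real CARD('n)"
      using that by (simp add: norm_matrix_power2 orthogonal_matrix_iff_inner_rows power2_norm_eq_inner)
    then show ?thesis by (metis norm_ge_zero real_sqrt_unique)
  qed
  then show "bounded {Q :: real^'n^'n. orthogonal_matrix Q}"
    unfolding bounded_iff by (metis mem_Collect_eq order_refl)
  show "closed {Q :: real^'n^'n. orthogonal_matrix Q}"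
    unfolding orthogonal_matrix_iff_inner_rows
    by (intro closed_Collect_all closed_Collect_eq continuous_intros)
qed

text \<open>These plane rotations of two rows are the perturbations against which a minimal frame is
  tested.\<close>

lemma orthogonal_matrix_rotate_rows:
  fixes Q :: "real^'n^'n"
  assumes "orthogonal_matrix Q" "i \<noteq> j" "c\<^sup>2 + s\<^sup>2 = 1"
  shows "orthogonal_matrix (\<chi> k. if k = i then c *\<^sub>R Q $ i - s *\<^sub>R Q $ j
            else if k = j then s *\<^sub>R Q $ i + c *\<^sub>R Q $ j else Q $ k)"
  using assms unfolding orthogonal_matrix_iff_inner_rows
  by (auto simp: inner_simps power2_eq_square algebra_simps)

text \<open>Near 0 the linear term dominates and changes sign with \<open>t\<close>.\<close>

lemma quadratic_nonneg_imp_linear_coeff_zero: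
  fixes w z :: real
  assumes "\<And>t. 0 \<le> t\<^sup>2 * w + t * z"
  shows "z = 0"
proof (rule ccontr)
  assume z: "z \<noteq> 0"
  \<comment> \<open>Any positive \<open>p\<close> exceeding \<open>w\<close> works: at
    \<open>t = - z / p\<close> the expression equals
    \<open>z\<^sup>2 / p\<^sup>2 * (w - p)\<close>.\<close>
  define p where "p = 1 + \<bar>w\<bar>"
  have p: "p > 0" "w - p < 0" by (auto simp: p_def)
  have "(- z / p)\<^sup>2 * w + (- z / p) * z = z\<^sup>2 / p\<^sup>2 * (w - p)"
    using p by (simp add: field_simps power2_eq_square)
  also have "\<dots> < 0" using p z by (intro mult_pos_neg) auto
  finally show False using assms[of "- z / p"] by simp
qed

text \<open>At a minimiser, every rotation in a coordinate plane is a first-order stationary perturbation;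
  for distinct weights this forces the off-diagonal entries to vanish.\<close>

lemma weighted_trace_minimizer_diagonal:
  fixes A Q :: "real^'n^'n" and d :: "'n \<Rightarrow> real"
  assumes A: "symmetric_mat A" and d: "inj d" and Q: "orthogonal_matrix Q"
    and min: "\<And>P. orthogonal_matrix P \<Longrightarrow>
      (\<Sum>i\<in>UNIV. d i * (Q $ i \<bullet> (A *v Q $ i))) \<le> (\<Sum>i\<in>UNIV. d i * (P $ i \<bullet> (A *v P $ i)))"
    and ij: "i \<noteq> j"
  shows "Q $ i \<bullet> (A *v Q $ j) = 0"
proof -
  define q where "q = (\<lambda>x y. x \<bullet> (A *v y))"
  have sym: "q y x = q x y" for x y
    using A unfolding q_def symmetric_mat_def
    by (metis dot_lmul_matrix inner_commute transpose_matrix_vector)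
  define a g e where "a = q (Q $ i) (Q $ i)" and "g = q (Q $ j) (Q $ j)" and "e = q (Q $ i) (Q $ j)"
  \<comment> \<open>The right side is the exact change of the weighted trace when rows
    \<open>i\<close> and \<open>j\<close> are rotated: only two summands change, and
    \<open>c\<^sup>2\<close> is replaced by \<open>1 - s\<^sup>2\<close>.\<close>
  have rot: "0 \<le> s\<^sup>2 * ((d j - d i) * (a - g)) + c * s * (2 * (d j - d i) * e)"
    if cs: "c\<^sup>2 + s\<^sup>2 = 1" for c s
  proof -
    define P where "P = (\<chi> k. if k = i then c *\<^sub>R Q $ i - s *\<^sub>R Q $ j
            else if k = j then s *\<^sub>R Q $ i + c *\<^sub>R Q $ j else Q $ k)"
    have "orthogonal_matrix P" unfolding P_def using Q ij cs by (rule orthogonal_matrix_rotate_rows)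
    from min[OF this]
    have "0 \<le> (\<Sum>k\<in>UNIV. d k * q (P $ k) (P $ k) - d k * q (Q $ k) (Q $ k))"
      by (simp add: sum_subtractf q_def)
    also have "\<dots> = (\<Sum>k\<in>{i, j}. d k * q (P $ k) (P $ k) - d k * q (Q $ k) (Q $ k))"
      by (rule sum.mono_neutral_right) (auto simp: P_def)
    also have "\<dots> = d i * (c\<^sup>2 * a - 2 * c * s * e + s\<^sup>2 * g - a) + d j * (s\<^sup>2 * a + 2 * c * s * e + c\<^sup>2 * g - g)"
    proof -
      have "q (P $ i) (P $ i) = c\<^sup>2 * a - 2 * c * s * e + s\<^sup>2 * g"
        using sym[of "Q $ i" "Q $ j"]
        by (simp add: P_def a_def g_def e_def q_def matrix_vector_mult_diff_distrib
            matrix_vector_mult_scaleR inner_simps power2_eq_square algebra_simps)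
      moreover have "q (P $ j) (P $ j) = s\<^sup>2 * a + 2 * c * s * e + c\<^sup>2 * g"
        using ij sym[of "Q $ i" "Q $ j"]
        by (simp add: P_def a_def g_def e_def q_def matrix_vector_right_distrib
            matrix_vector_mult_scaleR inner_simps power2_eq_square algebra_simps)
      ultimately show ?thesis
        using ij by (simp add: a_def g_def right_diff_distrib)
    qed
    also have "c\<^sup>2 = 1 - s\<^sup>2" using cs by simp
    finally show ?thesis by (simp add: algebra_simps)
  qed
  have "2 * (d j - d i) * e = 0"
  proof (rule quadratic_nonneg_imp_linear_coeff_zero)
    fix t :: real
    \<comment> \<open>Rotations are parametrised by the tangent \<open>t\<close> of the angle;
      multiplying by \<open>r\<^sup>2\<close> turns the inequality into a polynomial one in
      \<open>t\<close>.\<close>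
    define r where "r = sqrt (1 + t\<^sup>2)"
    have r: "r > 0" "r\<^sup>2 = 1 + t\<^sup>2" by (auto simp: r_def add_pos_nonneg)
    have "(1 / r)\<^sup>2 + (t / r)\<^sup>2 = 1"
      using r by (simp add: power_divide flip: add_divide_distrib r(2))
    from rot[OF this]
    have "0 \<le> r\<^sup>2 * ((t / r)\<^sup>2 * ((d j - d i) * (a - g)) + (1 / r) * (t / r) * (2 * (d j - d i) * e))"
      by simp
    also have "\<dots> = t\<^sup>2 * ((d j - d i) * (a - g)) + t * (2 * (d j - d i) * e)"
      using r(1) by (simp add: field_simps power2_eq_square)
    finally show "0 \<le> t\<^sup>2 * ((d j - d i) * (a - g)) + t * (2 * (d j - d i) * e)" .
  qed
  then show ?thesis using d ij by (auto simp: e_def q_def inj_eq)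
qed

text \<open>A continuous objective on a compact set has a minimiser, and stationarity makes that
  minimiser an eigenframe.\<close>

lemma ex_diagonalizing_rows_inj:
  fixes A :: "real^'n^'n" and d :: "'n \<Rightarrow> real"
  assumes A: "symmetric_mat A" and d: "inj d"
  obtains Q where "orthogonal_matrix Q" "\<And>i j. i \<noteq> j \<Longrightarrow> Q $ i \<bullet> (A *v Q $ j) = 0"
    "\<And>P. orthogonal_matrix P \<Longrightarrow>
      (\<Sum>i\<in>UNIV. d i * (Q $ i \<bullet> (A *v Q $ i))) \<le> (\<Sum>i\<in>UNIV. d i * (P $ i \<bullet> (A *v P $ i)))"
proof -
  define F where "F = (\<lambda>Q :: real^'n^'n. \<Sum>i\<in>UNIV. d i * (Q $ i \<bullet> (A *v Q $ i)))"
  let ?O = "{Q :: real^'n^'n. orthogonal_matrix Q}"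
  have "continuous_on ?O F"
    unfolding F_def
    by (intro continuous_intros matrix_vector_mult_linear_continuous_on[THEN continuous_on_compose2]) auto
  moreover have "?O \<noteq> {}" using orthogonal_matrix_id by blast
  ultimately have "\<exists>Q\<in>?O. \<forall>P\<in>?O. F Q \<le> F P"
    by (intro continuous_attains_inf compact_orthogonal_matrices)
  then obtain Q where Q: "orthogonal_matrix Q" and min: "\<And>P. orthogonal_matrix P \<Longrightarrow> F Q \<le> F P"
    by blast
  from min weighted_trace_minimizer_diagonal[OF A d Q] show thesis
    unfolding F_def by (intro that[OF Q]) blast+
qed

text \<open>The minimum over all orthonormal frames is attained at a frame of eigenvectors. For weights with
  repetitions, perturb them to distinct ones and use compactness of the set of eigenframes.\<close>

lemma ex_diagonalizing_rows:
  fixes A :: "real^'n^'n" and d :: "'n \<Rightarrow> real"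
  assumes A: "symmetric_mat A"
  obtains Q where "orthogonal_matrix Q" "\<And>i j. i \<noteq> j \<Longrightarrow> Q $ i \<bullet> (A *v Q $ j) = 0"
    "\<And>P. orthogonal_matrix P \<Longrightarrow>
      (\<Sum>i\<in>UNIV. d i * (Q $ i \<bullet> (A *v Q $ i))) \<le> (\<Sum>i\<in>UNIV. d i * (P $ i \<bullet> (A *v P $ i)))"
proof -
  define F where "F = (\<lambda>(d :: 'n \<Rightarrow> real) Q. \<Sum>i\<in>UNIV. d i * (Q $ i \<bullet> (A *v Q $ i)))"
  define O' where "O' = {Q :: real^'n^'n. orthogonal_matrix Q}"
  define K where "K = O' \<inter> {Q. \<forall>i j. i \<noteq> j \<longrightarrow> Q $ i \<bullet> (A *v Q $ j) = 0}"
  have O': "compact O'" unfolding O'_def by (rule compact_orthogonal_matrices)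
  have cont: "continuous_on UNIV (F d)" for d
    unfolding F_def
    by (intro continuous_intros matrix_vector_mult_linear_continuous_on[THEN continuous_on_compose2]) auto
  have "closed {Q :: real^'n^'n. \<forall>i j. i \<noteq> j \<longrightarrow> Q $ i \<bullet> (A *v Q $ j) = 0}"
    by (intro closed_Collect_all closed_Collect_imp open_Collect_const closed_Collect_eq continuous_intros
        matrix_vector_mult_linear_continuous_on[THEN continuous_on_compose2]) auto
  with O' have K: "compact K" unfolding K_def by (rule compact_Int_closed)
  \<comment> \<open>Distinct labels supply the direction in which the weights \<open>d\<close> are
    perturbed. As weights themselves they also show that \<open>K\<close> is nonempty.\<close>
  obtain u :: "'n \<Rightarrow> nat" where u: "inj u"
    using finite_imp_inj_to_nat_seg[of "UNIV :: 'n set"] by auto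
  have eigenframe: "\<exists>Q\<in>K. \<forall>P\<in>O'. F d Q \<le> F d P" if d: "inj d" for d
    by (rule ex_diagonalizing_rows_inj[OF A d]) (auto simp: K_def O'_def F_def)
  have "K \<noteq> {}" using eigenframe[of "\<lambda>i. real (u i)"] u by (auto simp: inj_def)
  then obtain Q where Q: "Q \<in> K" "\<And>P. P \<in> K \<Longrightarrow> F d Q \<le> F d P"
    using continuous_attains_inf[OF K _ continuous_on_subset[OF cont[of d] subset_UNIV]] by blast
  have "bounded (F (\<lambda>i. real (u i)) ` O')"
    by (intro compact_imp_bounded compact_continuous_image O' continuous_on_subset[OF cont]) auto
  then obtain B where B: "\<And>P. P \<in> O' \<Longrightarrow> \<bar>F (\<lambda>i. real (u i)) P\<bar> \<le> B"
    unfolding bounded_iff by auto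
  have "F d Q \<le> F d P" if P: "P \<in> O'" for P
  proof -
    \<comment> \<open>Finitely many perturbation sizes can make two weights coincide. Pairs with
      \<open>i = j\<close> contribute only 0, since division by zero gives 0.\<close>
    define bad where "bad = (\<lambda>(i, j). (d j - d i) / (real (u i) - real (u j))) ` (UNIV :: ('n \<times> 'n) set)"
    have inj: "inj (\<lambda>i. d i + e * real (u i))" if "e \<notin> bad" for e
    proof (rule injI, rule ccontr)
      fix i j assume eq: "d i + e * real (u i) = d j + e * real (u j)" and "i \<noteq> j"
      then have "real (u i) - real (u j) \<noteq> 0" using u by (auto simp: inj_def)
      then have "e = (d j - d i) / (real (u i) - real (u j))"
        using eq by (simp add: field_simps)
      then show False using that by (auto simp: bad_def)
    qed
    have "F d Q \<le> F d P + e" if "e > 0" for e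
    proof -
      have B0: "B \<ge> 0" using B[OF P] by linarith
      \<comment> \<open>The perturbation terms at \<open>P\<close> and \<open>Q'\<close> differ by
        at most \<open>2 * B * t\<close>, so this range of \<open>t\<close> keeps the error below
        \<open>e\<close>; the summand 1 avoids a zero denominator.\<close>
      have "infinite {0<..<e / (2 * B + 1)}" using that B0 by (simp add: infinite_Ioo)
      moreover have "finite bad" unfolding bad_def by simp
      ultimately have "{0<..<e / (2 * B + 1)} - bad \<noteq> {}"
        by (metis Diff_infinite_finite finite.emptyI)
      then obtain t where t: "0 < t" "t < e / (2 * B + 1)" "t \<notin> bad"
        by (auto simp only: ex_in_conv[symmetric] Diff_iff greaterThanLessThan_iff)
      obtain Q' where Q': "Q' \<in> K" and le: "F (\<lambda>i. d i + t * real (u i)) Q' \<le> F (\<lambda>i. d i + t * real (u i)) P"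
        using eigenframe[OF inj[OF t(3)]] P by blast
      have split: "F (\<lambda>i. d i + t * real (u i)) X = F d X + t * F (\<lambda>i. real (u i)) X" for X
        by (simp add: F_def algebra_simps sum.distrib sum_distrib_left)
      have "Q' \<in> O'" using Q' by (simp add: K_def)
      then have "t * F (\<lambda>i. real (u i)) P - t * F (\<lambda>i. real (u i)) Q' \<le> t * (2 * B)"
        using B[OF P] B[of Q'] t(1) by (simp flip: right_diff_distrib)
      also have "\<dots> \<le> t * (2 * B + 1)" using t(1) by simp
      also have "\<dots> \<le> e" using t B0 by (simp add: field_simps)
      finally show ?thesis using le Q(2)[OF Q'] unfolding split by linarith
    qed
    then show ?thesis by (rule field_le_epsilon)
  qed
  then show thesis using that[of Q] Q(1) by (auto simp: K_def O'_def F_def)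
qed

section \<open>Expansions in an orthonormal frame\<close>

lemma orthonormal_rows_expansion:
  fixes Q :: "real^'n^'n"
  assumes "orthogonal_matrix Q"
  shows "x = (\<Sum>i\<in>UNIV. (Q $ i \<bullet> x) *\<^sub>R Q $ i)"
proof -
  have "x = transpose Q *v (Q *v x)"
    using assms by (simp add: matrix_vector_mul_assoc orthogonal_matrix_def del: transpose_matrix_vector)
  also have "\<dots> = (\<Sum>i\<in>UNIV. (Q $ i \<bullet> x) *\<^sub>R Q $ i)"
    by (simp add: vec_eq_iff matrix_vector_mult_def transpose_def inner_vec_def mult.commute del: transpose_matrix_vector)
  finally show ?thesis .
qed

lemma quadratic_form_diagonalizing_rows:
  fixes A Q :: "real^'n^'n"
  assumes Q: "orthogonal_matrix Q" and off: "\<And>i j. i \<noteq> j \<Longrightarrow> Q $ i \<bullet> (A *v Q $ j) = 0"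
  shows "x \<bullet> (A *v x) = (\<Sum>i\<in>UNIV. (Q $ i \<bullet> (A *v Q $ i)) * (Q $ i \<bullet> x)\<^sup>2)"
proof -
  \<comment> \<open>When \<open>x\<close> is expanded in the frame only one term survives, so each
    row acts as a left eigenvector of \<open>A\<close>.\<close>
  have row: "Q $ i \<bullet> (A *v x) = (Q $ i \<bullet> (A *v Q $ i)) * (Q $ i \<bullet> x)" for i
  proof -
    have "Q $ i \<bullet> (A *v x) = Q $ i \<bullet> (A *v (\<Sum>j\<in>UNIV. (Q $ j \<bullet> x) *\<^sub>R Q $ j))"
      by (rule arg_cong[OF orthonormal_rows_expansion[OF Q]])
    also have "\<dots> = (\<Sum>j\<in>UNIV. (Q $ j \<bullet> x) * (Q $ i \<bullet> (A *v Q $ j)))"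
      by (simp add: matrix_vector_mul_linear[THEN linear_sum] matrix_vector_mult_scaleR inner_sum_right)
    also have "\<dots> = (\<Sum>j\<in>{i}. (Q $ j \<bullet> x) * (Q $ i \<bullet> (A *v Q $ j)))"
      by (rule sum.mono_neutral_right) (auto simp: off)
    finally show ?thesis by (simp add: mult.commute)
  qed
  have "x \<bullet> (A *v x) = (\<Sum>i\<in>UNIV. (Q $ i \<bullet> x) *\<^sub>R Q $ i) \<bullet> (A *v x)"
    by (rule arg_cong[OF orthonormal_rows_expansion[OF Q]])
  then show ?thesis
    by (simp add: inner_sum_left row power2_eq_square mult.commute mult.left_commute)
qed

lemma norm_power2_orthonormal_rows:
  fixes Q :: "real^'n^'n"
  assumes "orthogonal_matrix Q"
  shows "(norm x)\<^sup>2 = (\<Sum>i\<in>UNIV. (Q $ i \<bullet> x)\<^sup>2)"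
proof -
  have "(norm (Q *v x))\<^sup>2 = (\<Sum>i\<in>UNIV. (Q $ i \<bullet> x)\<^sup>2)"
    by (simp add: norm_vec_def L2_set_def sum_nonneg matrix_vector_mul_component)
  then show ?thesis by (simp add: norm_orthogonal_matrix_vector_mult[OF assms])
qed

section \<open>Matrix inverses and the Cauchy-Schwarz bound\<close>

lemma matrix_inv_unique:
  fixes A B :: "real^'n^'n"
  assumes "A ** B = mat 1"
  shows "matrix_inv A = B"
proof -
  have "B ** A = mat 1" using assms matrix_left_right_inverse by blast
  \<comment> \<open>\<open>matrix_inv\<close> is a choice among two-sided inverses; \<open>B\<close>
    witnesses that the choice succeeds.\<close>
  then have "A ** matrix_inv A = mat 1 \<and> matrix_inv A ** A = mat 1"
    unfolding matrix_inv_def using assms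
    by (intro someI[of "\<lambda>X. A ** X = mat 1 \<and> X ** A = mat 1" B] conjI)
  then have "B = B ** (A ** matrix_inv A)" by simp
  also have "\<dots> = matrix_inv A" unfolding matrix_mul_assoc \<open>B ** A = mat 1\<close> by simp
  finally show ?thesis ..
qed

lemma matrix_mult_matrix_inv:
  fixes A :: "real^'n^'n"
  assumes "invertible A"
  shows "A ** matrix_inv A = mat 1"
proof -
  from assms obtain B where "A ** B = mat 1" unfolding invertible_def by blast
  then show ?thesis using matrix_inv_unique[of A B] by simp
qed

lemma matrix_inv_transpose:
  fixes S :: "real^'n^'n"
  assumes "invertible S"
  shows "matrix_inv (transpose S) = transpose (matrix_inv S)"
proof (rule matrix_inv_unique)
  have "matrix_inv S ** S = mat 1"
    using matrix_mult_matrix_inv[OF assms] matrix_left_right_inverse by blast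
  then show "transpose S ** transpose (matrix_inv S) = mat 1"
    by (metis matrix_transpose_mul transpose_mat)
qed

text \<open>Put \<open>?w = matrix_inv (transpose S) *v v\<close>. Pairing \<open>v\<close> with the
  all-ones vector is pairing \<open>?w\<close> with its image under \<open>S\<close>, so
  Cauchy-Schwarz applies. Taking \<open>v\<close> as the quadratic vector and as the all-ones vector
  handles the first and third loss terms.\<close>

lemma sum_power2_le_norm_inv_transpose:
  fixes S :: "real^'n^'n"
  assumes S: "invertible S" and bound: "\<And>x. norm (S *v x) \<le> c * norm x"
  shows "(\<Sum>i\<in>UNIV. v $ i)\<^sup>2 \<le> c\<^sup>2 * real CARD('n) * (norm (matrix_inv (transpose S) *v v))\<^sup>2"
proof -
  let ?w = "matrix_inv (transpose S) *v v" and ?e = "\<chi> i. 1 :: real^'n"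
  have "transpose S *v ?w = v"
    using matrix_mult_matrix_inv[OF transpose_invertible[OF S]]
    by (simp add: matrix_vector_mul_assoc del: transpose_matrix_vector)
  then have "(\<Sum>i\<in>UNIV. v $ i) = ?e \<bullet> (transpose S *v ?w)"
    by (simp add: inner_vec_def)
  also have "\<dots> = (S *v ?e) \<bullet> ?w"
    by (metis dot_lmul_matrix inner_commute transpose_matrix_vector)
  finally have "\<bar>\<Sum>i\<in>UNIV. v $ i\<bar> \<le> norm (S *v ?e) * norm ?w"
    by (simp add: Cauchy_Schwarz_ineq2)
  also have "\<dots> \<le> c * norm ?e * norm ?w"
    by (intro mult_right_mono bound) auto
  finally have "(\<Sum>i\<in>UNIV. v $ i)\<^sup>2 \<le> (c * norm ?e * norm ?w)\<^sup>2"
    by (metis abs_ge_zero power2_abs power_mono)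
  moreover have "(norm ?e)\<^sup>2 = real CARD('n)"
    by (simp add: power2_norm_eq_inner inner_vec_def)
  ultimately show ?thesis by (simp add: power_mult_distrib)
qed

section \<open>Diagonal matrices, quadratic forms and feasibility\<close>

lemma diagonal_mult_component:
  fixes D :: "real^'n^'n"
  assumes "diagonal_mat D"
  shows "(D *v y) $ j = D $ j $ j * y $ j"
proof -
  have "(D *v y) $ j = (\<Sum>k\<in>{j}. D $ j $ k * y $ k)"
    unfolding matrix_vector_mult_def vec_lambda_beta using assms
    by (intro sum.mono_neutral_right) (auto simp: diagonal_mat_def)
  then show ?thesis by simp
qed

lemma quadratic_form_conj_diagonal:
  fixes R D :: "real^'n^'n"
  assumes "diagonal_mat D"
  shows "x \<bullet> ((R ** D ** transpose R) *v x) = (\<Sum>j\<in>UNIV. D $ j $ j * (transpose R $ j \<bullet> x)\<^sup>2)"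
proof -
  have "x \<bullet> ((R ** D ** transpose R) *v x) = x \<bullet> (R *v (D *v (transpose R *v x)))"
    by (simp only: matrix_vector_mul_assoc matrix_mul_assoc)
  also have "\<dots> = (transpose R *v x) \<bullet> (D *v (transpose R *v x))"
    by (metis dot_lmul_matrix transpose_matrix_vector)
  also have "\<dots> = (\<Sum>j\<in>UNIV. D $ j $ j * (transpose R $ j \<bullet> x)\<^sup>2)"
    unfolding inner_vec_def[of "transpose R *v x"] diagonal_mult_component[OF assms]
    by (simp add: matrix_vector_mul_component power2_eq_square algebra_simps del: transpose_matrix_vector)
  finally show ?thesis .
qed

text \<open>The left side is the trace of \<open>H ** S ** transpose S\<close> for the conjugated
  \<open>H\<close>. Written as a weighted sum over the rows of \<open>transpose R\<close>, it can be
  compared with the minimum over orthonormal frames.\<close>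

lemma sum_quad_vec_conj_diagonal:
  fixes R D S :: "real^'n^'n"
  assumes "diagonal_mat D"
  shows "(\<Sum>i\<in>UNIV. quad_vec (R ** D ** transpose R) S $ i)
    = (\<Sum>j\<in>UNIV. D $ j $ j * (norm (transpose S *v (transpose R $ j)))\<^sup>2)"
proof -
  have "(norm (transpose S *v y))\<^sup>2 = (\<Sum>i\<in>UNIV. (y \<bullet> column i S)\<^sup>2)" for y
    by (simp add: norm_vec_def L2_set_def sum_nonneg matrix_vector_mult_def transpose_def column_def
        inner_vec_def mult.commute del: transpose_matrix_vector)
  then show ?thesis
    unfolding quad_vec_def quadratic_form_conj_diagonal[OF assms]
    by (simp add: sum_distrib_left del: transpose_matrix_vector)
      (rule sum.swap)
qed

lemma trace_conj_orthogonal: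
  fixes R D :: "real^'n^'n"
  assumes "orthogonal_matrix R"
  shows "trace (R ** D ** transpose R) = trace D"
proof -
  have "trace (R ** D ** transpose R) = trace (transpose R ** (R ** D))"
    by (rule trace_mul_sym)
  also have "\<dots> = trace D"
    using assms by (simp add: matrix_mul_assoc orthogonal_matrix_def)
  finally show ?thesis .
qed

lemma diagonal_imp_symmetric_mat:
  assumes "diagonal_mat A"
  shows "symmetric_mat A"
  unfolding symmetric_mat_def vec_eq_iff transpose_def vec_lambda_beta
  using assms unfolding diagonal_mat_def by metis

lemma quadratic_form_diagonal:
  assumes "diagonal_mat A"
  shows "x \<bullet> (A *v x) = (\<Sum>i\<in>UNIV. A $ i $ i * (x $ i)\<^sup>2)"
  by (simp add: inner_vec_def diagonal_mult_component[OF assms] power2_eq_square algebra_simps)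

lemma diagonal_pos_def_iff:
  fixes A :: "real^'n^'n"
  assumes "diagonal_mat A"
  shows "pos_def A \<longleftrightarrow> (\<forall>i. 0 < A $ i $ i)"
proof -
  note sym = diagonal_imp_symmetric_mat[OF assms] and q = quadratic_form_diagonal[OF assms]
  show ?thesis
  proof
    assume "pos_def A"
    show "\<forall>i. 0 < A $ i $ i"
    proof
      fix i
      have "0 < axis i 1 \<bullet> (A *v axis i 1)"
        using \<open>pos_def A\<close> by (simp add: pos_def_def axis_eq_0_iff)
      also have "\<dots> = A $ i $ i"
        by (simp add: inner_axis' diagonal_mult_component[OF assms])
      finally show "0 < A $ i $ i" .
    qed
  next
    assume pos: "\<forall>i. 0 < A $ i $ i"
    have "0 < x \<bullet> (A *v x)" if "x \<noteq> 0" for x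
    proof -
      obtain i where "x $ i \<noteq> 0" using \<open>x \<noteq> 0\<close> by (auto simp: vec_eq_iff)
      then show ?thesis
        unfolding q using pos by (intro sum_pos2[of _ i]) (auto simp: less_imp_le)
    qed
    with sym show "pos_def A" by (simp add: pos_def_def)
  qed
qed

lemma diagonal_pos_semidef_iff:
  fixes A :: "real^'n^'n"
  assumes "diagonal_mat A"
  shows "pos_semidef A \<longleftrightarrow> (\<forall>i. 0 \<le> A $ i $ i)"
proof -
  note sym = diagonal_imp_symmetric_mat[OF assms] and q = quadratic_form_diagonal[OF assms]
  show ?thesis
  proof
    assume "pos_semidef A"
    show "\<forall>i. 0 \<le> A $ i $ i"
    proof
      fix i
      have "0 \<le> axis i 1 \<bullet> (A *v axis i 1)"
        using \<open>pos_semidef A\<close> by (simp add: pos_semidef_def)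
      also have "\<dots> = A $ i $ i"
        by (simp add: inner_axis' diagonal_mult_component[OF assms])
      finally show "0 \<le> A $ i $ i" .
    qed
  next
    assume "\<forall>i. 0 \<le> A $ i $ i"
    then show "pos_semidef A"
      using sym by (auto simp: pos_semidef_def q intro!: sum_nonneg)
  qed
qed

lemma diagonal_feasible_iff:
  fixes A :: "real^'n^'n"
  assumes "diagonal_mat A"
  shows "pos_semidef (h *\<^sub>R mat 1 - A) \<and> pos_def A \<longleftrightarrow> (\<forall>i. 0 < A $ i $ i \<and> A $ i $ i \<le> h)"
proof -
  have "diagonal_mat (h *\<^sub>R mat 1 - A)"
    using assms by (simp add: diagonal_mat_def mat_def)
  from diagonal_pos_semidef_iff[OF this] diagonal_pos_def_iff[OF assms]
  show ?thesis by (auto simp: mat_def)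
qed

lemma max_diag_eqI:
  fixes A :: "real^'n^'n"
  assumes "\<And>i. A $ i $ i \<le> A $ k $ k"
  shows "max_diag A = A $ k $ k"
  unfolding max_diag_def by (rule Max_eqI) (use assms in auto)

section \<open>Lower bound for the loss by the reduced loss\<close>

lemma ex_raised_weights:
  fixes b d :: "'n::finite \<Rightarrow> real"
  assumes bm: "\<And>i. b i \<le> m" and m: "0 < m" and d: "0 < (\<Sum>i\<in>UNIV. d i)"
    and T: "(\<Sum>i\<in>UNIV. d i * b i) \<le> T"
  obtains c where "\<And>i. b i \<le> c i" "\<And>i. c i \<le> m" "(\<Sum>i\<in>UNIV. d i * c i)\<^sup>2 \<le> T\<^sup>2"
proof (cases "0 \<le> (\<Sum>i\<in>UNIV. d i * b i)")
  case True
  then show thesis using that[of b] bm T by (simp add: power_mono)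
next
  case False
  \<comment> \<open>On the segment from \<open>b\<close> to the constant \<open>m\<close>, the
    weighted sum moves from \<beta> < 0 to \<open>m\<close> times the positive sum of the
    \<open>d i\<close>; \<open>t\<close> is where it vanishes.\<close>
  define \<beta> t where "\<beta> = (\<Sum>i\<in>UNIV. d i * b i)" and "t = - \<beta> / (m * (\<Sum>i\<in>UNIV. d i) - \<beta>)"
  have "0 < m * (\<Sum>i\<in>UNIV. d i)" using m d by simp
  moreover have "\<beta> < 0" using False by (simp add: \<beta>_def)
  ultimately have den: "0 < m * (\<Sum>i\<in>UNIV. d i) - \<beta>" and t: "0 \<le> t" "t \<le> 1"
    by (auto simp: t_def field_simps)
  have "(\<Sum>i\<in>UNIV. d i * (b i + t * (m - b i))) = \<beta> + t * (m * (\<Sum>i\<in>UNIV. d i) - \<beta>)"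
    by (simp add: \<beta>_def algebra_simps sum.distrib sum_subtractf sum_distrib_left)
  also have "\<dots> = 0" using den by (simp add: t_def)
  finally have zero: "(\<Sum>i\<in>UNIV. d i * (b i + t * (m - b i))) = 0" .
  show thesis
  proof (rule that)
    fix i
    show "b i \<le> b i + t * (m - b i)" using t bm[of i] by simp
    show "b i + t * (m - b i) \<le> m"
      using mult_right_mono[OF t(2), of "m - b i"] bm[of i] by simp
  qed (simp add: zero)
qed

lemma ex_diagonal_reduced_loss_le:
  fixes R D S :: "real^'n^'n"
  assumes R: "orthogonal_matrix R" and D: "diagonal_mat D" and tr: "0 < trace D"
  shows "\<exists>\<Sigma>. diagonal_mat \<Sigma> \<and> reduced_loss D \<sigma> h \<Sigma> \<le> loss (R ** D ** transpose R) \<sigma> h S"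
proof (cases "invertible S \<and> spectral_norm S \<le> h")
  case False
  have "diagonal_mat (0 :: real^'n^'n)" by (simp add: diagonal_mat_def)
  with False show ?thesis unfolding loss_def by auto
next
  case True
  then have S: "invertible S" and norm_S: "spectral_norm S \<le> h" by auto
  have Sh: "norm (S *v x) \<le> h * norm x" for x
  proof -
    have "norm (S *v x) \<le> spectral_norm S * norm x"
      unfolding spectral_norm_def by (rule onorm) (rule matrix_vector_mul_bounded_linear)
    also have "\<dots> \<le> h * norm x" using norm_S by (rule mult_right_mono) simp
    finally show ?thesis .
  qed
  let ?H = "R ** D ** transpose R" and ?A = "S ** transpose S" and ?n = "real CARD('n)"
  have form: "x \<bullet> (?A *v x) = (norm (transpose S *v x))\<^sup>2" for x
  proof -
    have "x \<bullet> (?A *v x) = x \<bullet> (S *v (transpose S *v x))"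
      by (simp only: matrix_vector_mul_assoc)
    also have "\<dots> = (transpose S *v x) \<bullet> (transpose S *v x)"
      by (metis dot_lmul_matrix transpose_matrix_vector)
    finally show ?thesis by (simp only: power2_norm_eq_inner)
  qed
  have sym: "symmetric_mat ?A"
    by (simp add: symmetric_mat_def matrix_transpose_mul)
  obtain Q where Q: "orthogonal_matrix Q" and off: "\<And>i j. i \<noteq> j \<Longrightarrow> Q $ i \<bullet> (?A *v Q $ j) = 0"
    and min: "\<And>P. orthogonal_matrix P \<Longrightarrow> (\<Sum>i\<in>UNIV. D $ i $ i * (Q $ i \<bullet> (?A *v Q $ i)))
        \<le> (\<Sum>i\<in>UNIV. D $ i $ i * (P $ i \<bullet> (?A *v P $ i)))"
    by (rule ex_diagonalizing_rows[OF sym, of "\<lambda>i. D $ i $ i"]) (rule that, assumption, blast+)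
  have Q1: "norm (Q $ i) = 1" for i
    using Q by (simp add: orthogonal_matrix_iff_inner_rows norm_eq_1)
  define b where "b = (\<lambda>i. (norm (transpose S *v (Q $ i)))\<^sup>2)"
  \<comment> \<open>The vectors \<open>transpose S *v (Q $ i)\<close> and
    \<open>matrix_inv S *v (Q $ i)\<close> have inner product 1, so Cauchy-Schwarz gives both
    claims.\<close>
  have inv: "1 / b i \<le> (norm (matrix_inv S *v (Q $ i)))\<^sup>2 \<and> 0 < b i" for i
  proof -
    let ?w = "matrix_inv S *v (Q $ i)" and ?v = "transpose S *v (Q $ i)"
    have "1 = Q $ i \<bullet> (S *v ?w)"
      using Q1[of i] by (simp add: matrix_vector_mul_assoc matrix_mult_matrix_inv[OF S] norm_eq_1)
    also have "\<dots> = ?v \<bullet> ?w" by (metis dot_lmul_matrix transpose_matrix_vector)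
    also have "\<dots> \<le> norm ?v * norm ?w" by (rule norm_cauchy_schwarz)
    finally have "1 \<le> norm ?v * norm ?w" .
    then have le: "1 \<le> b i * (norm ?w)\<^sup>2"
      using power_mono[of 1 "norm ?v * norm ?w" 2]
      by (simp add: b_def power_mult_distrib del: transpose_matrix_vector)
    then have "b i \<noteq> 0" by auto
    then have "0 < b i" by (simp add: b_def del: transpose_matrix_vector)
    with le show ?thesis by (simp add: field_simps)
  qed
  have bpos: "0 < b i" for i using inv by blast
  have bh: "b i \<le> h\<^sup>2" for i
    using norm_transpose_mult_le[OF Sh, of "Q $ i"] Q1[of i]
    by (simp add: b_def power_mono del: transpose_matrix_vector)
  have "0 \<le> h"
    using order_trans[OF norm_ge_zero Sh[of "axis undefined 1"]] by simp
  define m where "m = Max (range b)"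
  have bm: "b i \<le> m" for i by (simp add: m_def)
  have "m \<in> range b" unfolding m_def by (rule Max_in) auto
  then obtain k where k: "m = b k" by auto
  have m: "0 < m" using bpos k by simp
  \<comment> \<open>In the eigenframe the form of \<open>S ** transpose S\<close> has coefficients
    at most \<open>m\<close>. The resulting bound passes from the transpose to \<open>S\<close> and
    puts \<open>m\<close>, rather than \<open>h\<^sup>2\<close>, into the denominators
    below.\<close>
  have "norm (transpose S *v x) \<le> sqrt m * norm x" for x
  proof (rule power2_le_imp_le)
    have "(norm (transpose S *v x))\<^sup>2 = (\<Sum>i\<in>UNIV. b i * (Q $ i \<bullet> x)\<^sup>2)"
      using quadratic_form_diagonalizing_rows[OF Q off, of x] unfolding form b_def .
    also have "\<dots> \<le> (\<Sum>i\<in>UNIV. m * (Q $ i \<bullet> x)\<^sup>2)"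
      by (intro sum_mono mult_right_mono bm) auto
    also have "\<dots> = (sqrt m * norm x)\<^sup>2"
      using m by (simp add: norm_power2_orthonormal_rows[OF Q, of x] sum_distrib_left power_mult_distrib)
    finally show "(norm (transpose S *v x))\<^sup>2 \<le> (sqrt m * norm x)\<^sup>2" .
  qed (use m in simp)
  then have Sm: "norm (S *v x) \<le> sqrt m * norm x" for x
    using norm_transpose_mult_le[of "transpose S" "sqrt m" x] by (simp only: transpose_transpose)
  define T where "T = (\<Sum>i\<in>UNIV. quad_vec ?H S $ i)"
  have "0 < (\<Sum>i\<in>UNIV. D $ i $ i)" using tr by (simp add: trace_def)
  \<comment> \<open>The rows of \<open>transpose R\<close> are a competing orthonormal frame, with
    weighted sum exactly \<open>T\<close>.\<close>
  moreover have "(\<Sum>i\<in>UNIV. D $ i $ i * b i) \<le> T"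
    using min[of "transpose R"] R
    unfolding T_def sum_quad_vec_conj_diagonal[OF D] form b_def by simp
  ultimately obtain c where bc: "\<And>i. b i \<le> c i" and cm: "\<And>i. c i \<le> m"
    and cT: "(\<Sum>i\<in>UNIV. D $ i $ i * c i)\<^sup>2 \<le> T\<^sup>2"
    by (rule ex_raised_weights[OF bm m]) (rule that; simp)
  have cpos: "0 < c i" for i using bpos[of i] bc[of i] by linarith
  \<comment> \<open>Since \<open>b k \<le> c k \<le> m = b k\<close>, raising the weights keeps
    their maximum, so the largest diagonal entry of \<Sigma> is \<open>sqrt m\<close>.\<close>
  have ck: "c k = m" using bc[of k] cm[of k] k by simp
  define \<Sigma> :: "real^'n^'n" where "\<Sigma> = (\<chi> i j. if i = j then sqrt (c i) else 0)"
  have diag: "diagonal_mat \<Sigma>" by (simp add: diagonal_mat_def \<Sigma>_def)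
  have sq: "(\<Sigma> $ i $ i)\<^sup>2 = c i" for i using cpos[of i] by (simp add: \<Sigma>_def)
  have "c i \<le> h\<^sup>2" for i using cm[of i] bh[of k] k by simp
  then have "\<forall>i. 0 < \<Sigma> $ i $ i \<and> \<Sigma> $ i $ i \<le> h"
    using cpos \<open>0 \<le> h\<close> by (simp add: \<Sigma>_def real_le_lsqrt)
  then have feasible: "pos_semidef (h *\<^sub>R mat 1 - \<Sigma>) \<and> pos_def \<Sigma>"
    using diagonal_feasible_iff[OF diag] by blast
  have "max_diag \<Sigma> = \<Sigma> $ k $ k"
    by (rule max_diag_eqI) (use cm ck in \<open>simp add: \<Sigma>_def\<close>)
  then have max: "(max_diag \<Sigma>)\<^sup>2 = m" by (simp add: sq ck)
  let ?q = "norm (matrix_inv (transpose S) *v quad_vec ?H S)"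
    and ?e = "norm (matrix_inv (transpose S) *v (\<chi> i. 1))"
  have bound: "(\<Sum>i\<in>UNIV. v $ i)\<^sup>2 \<le> m * ?n * (norm (matrix_inv (transpose S) *v v))\<^sup>2" for v
    using sum_power2_le_norm_inv_transpose[OF S Sm, of v] m by simp
  have "(\<Sum>i\<in>UNIV. D $ i $ i * c i)\<^sup>2 / (4 * ?n * m) \<le> 1 / 4 * ?q\<^sup>2"
    using order_trans[OF cT bound[of "quad_vec ?H S", folded T_def]] m by (simp add: field_simps)
  \<comment> \<open>Raising the weights only lowers their reciprocals; the Frobenius norm is then
    summed over the eigenframe.\<close>
  moreover have "(\<Sum>i\<in>UNIV. 1 / c i) \<le> (norm (matrix_inv S))\<^sup>2"
  proof -
    have "(\<Sum>i\<in>UNIV. 1 / c i) \<le> (\<Sum>i\<in>UNIV. (norm (matrix_inv S *v (Q $ i)))\<^sup>2)"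
    proof (rule sum_mono)
      fix i
      have "1 / c i \<le> 1 / b i" using bc bpos by (simp add: frac_le)
      then show "1 / c i \<le> (norm (matrix_inv S *v (Q $ i)))\<^sup>2" using inv[of i] by linarith
    qed
    then show ?thesis by (simp add: sum_norm_mult_orthogonal_rows[OF Q])
  qed
  moreover have "?n / m \<le> ?e\<^sup>2"
    using bound[of "\<chi> i. 1"] m by (simp add: power2_eq_square field_simps)
  ultimately have "(\<Sum>i\<in>UNIV. D $ i $ i * c i)\<^sup>2 / (4 * ?n * m) + \<sigma>\<^sup>2 * (\<Sum>i\<in>UNIV. 1 / c i) + \<sigma>\<^sup>2 * (?n / m)
    \<le> 1 / 4 * ?q\<^sup>2 + \<sigma>\<^sup>2 * (norm (matrix_inv S))\<^sup>2 + \<sigma>\<^sup>2 * ?e\<^sup>2"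
    by (intro add_mono mult_left_mono) auto
  then have "reduced_loss D \<sigma> h \<Sigma> \<le> loss ?H \<sigma> h S"
    unfolding reduced_loss_def loss_def if_P[OF True] if_P[OF feasible] sq max
    by (rule ennreal_leI)
  with diag show ?thesis by blast
qed

section \<open>Attainment by the Hadamard construction\<close>

lemma hadamard_transpose_mult_ones:
  assumes "hadamard_mat k (V :: real^'n^'n)"
  shows "transpose V *v (\<chi> i. 1) = sqrt (real CARD('n)) *\<^sub>R axis k 1"
proof -
  let ?r = "sqrt (real CARD('n))"
  have "V $ i $ k = 1 / ?r" for i
  proof (rule power2_eq_imp_eq)
    show "(V $ i $ k)\<^sup>2 = (1 / ?r)\<^sup>2"
      using assms by (simp add: hadamard_mat_def power_divide)
    show "0 \<le> V $ i $ k" using assms by (simp add: hadamard_mat_def less_imp_le)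
  qed simp
  \<comment> \<open>Column \<open>k\<close> is constant, so the all-ones vector is a multiple of it,
    and \<open>transpose V\<close> sends that column back to the basis vector.\<close>
  then have ones: "(\<chi> i. 1) = ?r *\<^sub>R (V *v axis k 1)"
    by (simp add: vec_eq_iff matrix_vector_mult_basis column_def)
  have "transpose V ** V = mat 1"
    using assms by (simp add: hadamard_mat_def orthogonal_matrix_def)
  then show ?thesis
    unfolding ones matrix_vector_mult_scaleR by (simp add: matrix_vector_mul_assoc del: transpose_matrix_vector)
qed

text \<open>In the feasible case each term is computed exactly: the Frobenius norm ignores
  \<open>R\<close> and \<open>V\<close>, and the quadratic vector is a multiple of the all-ones
  vector, which reduces the first term to the third.\<close>

lemma loss_le_reduced_loss:
  fixes R D \<Sigma> V :: "real^'n^'n"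
  assumes R: "orthogonal_matrix R" and D: "diagonal_mat D" and \<Sigma>: "diagonal_mat \<Sigma>"
    and max: "\<And>i. \<Sigma> $ i $ i \<le> \<Sigma> $ k $ k" and V: "hadamard_mat k V"
  shows "loss (R ** D ** transpose R) \<sigma> h (R ** \<Sigma> ** transpose V) \<le> reduced_loss D \<sigma> h \<Sigma>"
proof (cases "pos_semidef (h *\<^sub>R mat 1 - \<Sigma>) \<and> pos_def \<Sigma>")
  case False
  then show ?thesis unfolding reduced_loss_def by auto
next
  case True
  define g where "g = (\<lambda>i. \<Sigma> $ i $ i)"
  have g: "0 < g i" "g i \<le> h" for i
    using True unfolding diagonal_feasible_iff[OF \<Sigma>] g_def by auto
  have h: "0 < h" using g[of k] by linarith
  have oV: "orthogonal_matrix V" and Vsq: "(V $ i $ j)\<^sup>2 = 1 / real CARD('n)" for i j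
    using V by (auto simp: hadamard_mat_def)
  let ?H = "R ** D ** transpose R" and ?n = "real CARD('n)"
  define S where "S = R ** \<Sigma> ** transpose V"
  define W :: "real^'n^'n" where "W = (\<chi> i j. if i = j then 1 / g i else 0)"
  have W: "diagonal_mat W" by (simp add: diagonal_mat_def W_def)
  have W_mult: "(W *v x) $ i = x $ i / g i" for x i
    unfolding diagonal_mult_component[OF W] by (simp add: W_def)
  have "(\<Sigma> ** W) *v x = x" for x
    using less_imp_neq[OF g(1), symmetric]
    by (simp add: vec_eq_iff diagonal_mult_component[OF \<Sigma>] W_mult
        flip: matrix_vector_mul_assoc) (simp add: g_def)
  then have \<Sigma>W: "\<Sigma> ** W = mat 1" by (simp add: matrix_eq)
  have "S ** (V ** W ** transpose R) = R ** (\<Sigma> ** ((transpose V ** V) ** W)) ** transpose R"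
    by (simp only: S_def matrix_mul_assoc)
  also have "\<dots> = mat 1"
    using oV R by (simp add: orthogonal_matrix_def \<Sigma>W)
  finally have right: "S ** (V ** W ** transpose R) = mat 1" .
  then have S: "invertible S" by (auto simp: invertible_right_inverse)
  have inv: "matrix_inv S = V ** W ** transpose R" using right by (rule matrix_inv_unique)
  have "transpose W = W" by (simp add: W_def transpose_def vec_eq_iff)
  then have invT: "matrix_inv (transpose S) = R ** (W ** transpose V)"
    by (simp add: matrix_inv_transpose[OF S] inv matrix_transpose_mul)
  have "spectral_norm S \<le> h"
    unfolding spectral_norm_def
  proof (rule onorm_bound)
    fix x
    have "norm (S *v x) = norm (\<Sigma> *v (transpose V *v x))"
      using norm_orthogonal_matrix_vector_mult[OF R]
      by (simp only: S_def flip: matrix_vector_mul_assoc)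
    also have "\<dots> \<le> norm (h *\<^sub>R (transpose V *v x))"
      by (rule norm_le_componentwise_cart)
        (use g h in \<open>auto simp: diagonal_mult_component[OF \<Sigma>] abs_mult less_imp_le
          g_def intro!: mult_right_mono simp del: transpose_matrix_vector\<close>)
    also have "\<dots> = h * norm x"
      using oV h norm_orthogonal_matrix_vector_mult[of "transpose V" x]
      by (simp del: transpose_matrix_vector)
    finally show "norm (S *v x) \<le> h * norm x" .
  qed (use h in simp)
  with S have cond: "invertible S \<and> spectral_norm S \<le> h" ..
  have ones: "(norm (matrix_inv (transpose S) *v (\<chi> i. 1)))\<^sup>2 = ?n / (g k)\<^sup>2"
  proof -
    have Wk: "W *v axis k 1 = (1 / g k) *\<^sub>R axis k 1"
      by (simp add: vec_eq_iff W_mult axis_def)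
    have "matrix_inv (transpose S) *v (\<chi> i. 1) = R *v ((sqrt ?n / g k) *\<^sub>R axis k 1)"
      unfolding invT
      by (simp only: hadamard_transpose_mult_ones[OF V] matrix_vector_mult_scaleR Wk flip: matrix_vector_mul_assoc) simp
    then show ?thesis
      by (simp add: norm_orthogonal_matrix_vector_mult[OF R] power_divide)
  qed
  define s where "s = (\<Sum>i\<in>UNIV. D $ i $ i * (g i)\<^sup>2)"
  have quad: "quad_vec ?H S = (s / ?n) *\<^sub>R (\<chi> i. 1)"
  proof -
    \<comment> \<open>In the frame of the rows of \<open>transpose R\<close>, every column of
      \<open>S\<close> has squared coordinates \<open>(g j)\<^sup>2 / ?n\<close>, independent of the
      column.\<close>
    have "transpose R $ j \<bullet> column i S = g j * V $ i $ j" for i j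
    proof -
      have "transpose R $ j \<bullet> column i S = (transpose R ** S) $ j $ i"
        by (simp add: inner_vec_def column_def matrix_matrix_mult_def)
      also have "transpose R ** S = \<Sigma> ** transpose V"
        using R by (simp add: S_def matrix_mul_assoc orthogonal_matrix_def)
      also have "(\<Sigma> ** transpose V) $ j $ i = (\<Sigma> *v (V $ i)) $ j"
        by (simp add: matrix_matrix_mult_def matrix_vector_mult_def transpose_def)
      finally show ?thesis by (simp add: diagonal_mult_component[OF \<Sigma>] g_def)
    qed
    then show ?thesis
      unfolding quad_vec_def quadratic_form_conj_diagonal[OF D]
      by (simp add: vec_eq_iff power_mult_distrib Vsq s_def sum_divide_distrib)
  qed
  have "(norm (matrix_inv (transpose S) *v quad_vec ?H S))\<^sup>2 = (s / ?n)\<^sup>2 * (?n / (g k)\<^sup>2)"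
    unfolding quad matrix_vector_mult_scaleR by (simp only: norm_scaleR power_mult_distrib power2_abs ones)
  then have first: "1 / 4 * (norm (matrix_inv (transpose S) *v quad_vec ?H S))\<^sup>2 = s\<^sup>2 / (4 * ?n * (g k)\<^sup>2)"
    by (simp add: power2_eq_square)
  have "norm (matrix_inv S) = norm W"
    using R oV by (simp add: inv norm_matrix_mult_orthogonal_left norm_matrix_mult_orthogonal_right)
  moreover have "W $ i = (1 / g i) *\<^sub>R axis i 1" for i
    by (simp add: vec_eq_iff W_def axis_def)
  ultimately have second: "(norm (matrix_inv S))\<^sup>2 = (\<Sum>i\<in>UNIV. 1 / (g i)\<^sup>2)"
    by (simp add: norm_matrix_power2 power_divide)
  have "max_diag \<Sigma> = g k" unfolding g_def using max by (rule max_diag_eqI)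
  then show ?thesis
    unfolding S_def[symmetric] loss_def reduced_loss_def if_P[OF True] if_P[OF cond] ones first second
    by (simp add: s_def g_def)
qed

theorem theorem6:
  fixes H R D U \<Sigma> V :: "real ^ ('d :: {finite, linorder}) ^ ('d :: {finite, linorder})"
    and \<sigma> h :: real and k :: "'d :: {finite, linorder}"
  assumes "\<exists>m::nat. CARD('d :: {finite, linorder}) = 2 ^ m"
    and "\<sigma> > 0" and "h > 0"
    and "symmetric_mat H" and "trace H > 0"
    and "orthogonal_matrix R" and "diagonal_mat D"
    and "\<forall>i j. i \<le> j \<longrightarrow> D $ i $ i \<le> D $ j $ j"
    and "H = R ** D ** transpose R"
    and "U = mat 1"
    and "is_arg_min (reduced_loss D \<sigma> h) diagonal_mat \<Sigma>"
    and "is_arg_max (\<lambda>i. \<Sigma> $ i $ i) (\<lambda>_. True) k"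
    and "hadamard_mat k V"
  shows "is_arg_min (loss H \<sigma> h) (\<lambda>_. True) (R ** U ** \<Sigma> ** transpose V)"
proof -
  have \<Sigma>: "diagonal_mat \<Sigma>" and min: "\<And>X. diagonal_mat X \<Longrightarrow> reduced_loss D \<sigma> h \<Sigma> \<le> reduced_loss D \<sigma> h X"
    using assms(11) by (auto simp: is_arg_min_linorder)
  have max: "\<And>i. \<Sigma> $ i $ i \<le> \<Sigma> $ k $ k"
    using assms(12) by (auto simp: is_arg_max_linorder)
  have "0 < trace D"
    using assms(5,6,9) by (simp add: trace_conj_orthogonal)
  \<comment> \<open>The chain runs from the loss at the candidate to the reduced loss at \<Sigma>,
    then to that at \<open>X\<close>, then to the loss at \<open>S\<close>.\<close>
  have "loss H \<sigma> h (R ** \<Sigma> ** transpose V) \<le> loss H \<sigma> h S" for S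
  proof -
    obtain X where "diagonal_mat X" "reduced_loss D \<sigma> h X \<le> loss H \<sigma> h S"
      using ex_diagonal_reduced_loss_le[OF assms(6,7) \<open>0 < trace D\<close>] assms(9) by blast
    then show ?thesis
      using loss_le_reduced_loss[OF assms(6,7) \<Sigma> max assms(13)] min assms(9) by (meson order_trans)
  qed
  then show ?thesis by (simp add: is_arg_min_linorder assms(10))
qed

end
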